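(* Let $m\ge3$ and let $\mathsf S(\mathbf d^m)$ be the numerical semigroup minimally generated by $\mathbf d^m=\{d_1,\dots,d_m\}$, $\gcd(d_1,\dots,d_m)=1$, with Hilbert series $$H(\mathbf d^m;z)=\sum_{s\in\mathsf S(\mathbf d^m)}z^s=\frac{Q(\mathbf d^m;z)}{\prod_{i=1}^m(1-z^{d_i})},\qquad Q(\mathbf d^m;z)=1+\sum_{i=1}^{m-1}(-1)^i\sum_{j=1}^{\beta_i(\mathbf d^m)}z^{C_{j,i}},$$ where $\beta_i(\mathbf d^m)$ are the Betti numbers and $C_{j,i}$ the degrees of the syzygies of the $i$th kind. Then for every $d_k\in\mathbf d^m$, $1\le k\le m$, and every integer $n$ with $\gcd(n,d_k)=1$, $1\le n<d_k$, one has (with $\mathrm i=\sqrt{-1}$) $$\sum_{j=1}^{\beta_1(\mathbf d^m)}\exp\left(\mathrm i\frac{2\pi n}{d_k}C_{j,1}\right)-\sum_{j=1}^{\beta_2(\mathbf d^m)}\exp\left(\mathrm i\frac{2\pi n}{d_k}C_{j,2}\right)+\ldots+(-1)^m\sum_{j=1}^{\beta_{m-1}(\mathbf d^m)}\exp\left(\mathrm i\frac{2\pi n}{d_k}C_{j,m-1}\right)=1 .$$ (The sum over the $l$th syzygies enters with sign $(-1)^{l-1}$.)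
   Context: $\mathsf S(\mathbf d^m)=\{\sum_{i=1}^m x_id_i : x_i\in\mathbb Z_{\ge0}\}$ is a numerical semigroup generated by a minimal set of positive integers $d_1<\dots<d_m$ with $\gcd(d_1,\dots,d_m)=1$; minimal means that no $d_i$ is a nonnegative integer combination of the others. Its Hilbert series is a rational function $Q(\mathbf d^m;z)/\prod_{i=1}^m(1-z^{d_i})$ with polynomial numerator $Q=1-Q_1+Q_2-\dots+(-1)^{m-1}Q_{m-1}$, $Q_i=\sum_{j=1}^{\beta_i(\mathbf d^m)}z^{C_{j,i}}$. Here $\beta_i(\mathbf d^m)$ is the $i$th Betti number and the positive integers $C_{j,i}$, $1\le j\le\beta_i(\mathbf d^m)$ (listed with multiplicity, in nondecreasing order in $j$), are the degrees of the syzygies of the $i$th kind in a minimal free resolution of the semigroup ring. The convention is that all cancellations of terms $z^{C_{j,i}}$ with opposite signs in $Q$ are already performed, i.e. $C_{j,i}\ne C_{r,i+2k-1}$ for $1\le k\le\lfloor (m-i)/2\rfloor$. *)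

theory Defs
  imports Complex_Main "HOL-Library.Poly_Mapping" "HOL-Library.Multiset"
    "HOL-Computational_Algebra.Polynomial"
begin

definition generated_semigroup :: "(nat \<Rightarrow> nat) \<Rightarrow> nat set \<Rightarrow> nat set" where
  "generated_semigroup d I = {\<Sum>i\<in>I. x i * d i | x :: nat \<Rightarrow> nat. True}"

definition minimal_generators :: "nat \<Rightarrow> (nat \<Rightarrow> nat) \<Rightarrow> bool" where
  "minimal_generators m d \<longleftrightarrow>
     (\<forall>i\<in>{1..m}. 0 < d i) \<and>
     strict_mono_on {1..m} d \<and>
     Gcd (d ` {1..m}) = 1 \<and>
     (\<forall>i\<in>{1..m}. d i \<notin> generated_semigroup d ({1..m} - {i}))"

text \<open>
  Exponent vectors are finitely supported maps from variable indices to exponents; multiplication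
  of polynomials is the convolution product of the \<open>poly_mapping\<close> ring instance.
  The polynomial ring in \<open>x\<^sub>1, \<dots>, x\<^sub>m\<close> consists of the polynomials
  in which no other variable occurs.
\<close>

type_synonym 'k mpoly = "(nat \<Rightarrow>\<^sub>0 nat) \<Rightarrow>\<^sub>0 'k"

definition polynomial_ring :: "nat \<Rightarrow> 'k::field mpoly set" where
  "polynomial_ring m = {p. \<forall>t\<in>Poly_Mapping.keys p. Poly_Mapping.keys t \<subseteq> {1..m}}"

text \<open>The degree of a monomial in the grading with \<open>deg x\<^sub>i = d\<^sub>i\<close>.\<close>

definition weighted_degree :: "nat \<Rightarrow> (nat \<Rightarrow> nat) \<Rightarrow> (nat \<Rightarrow>\<^sub>0 nat) \<Rightarrow> nat" where
  "weighted_degree m d t = (\<Sum>i=1..m. Poly_Mapping.lookup t i * d i)"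

text \<open>
  The semigroup ring is the subring of \<open>k[z]\<close> spanned by the \<open>z\<^sup>s\<close>
  with \<open>s\<close> in the semigroup. It is a module over the polynomial ring through the
  homomorphism sending \<open>x\<^sub>i\<close> to \<open>z\<close> to the power \<open>d\<^sub>i\<close>.
\<close>

definition semigroup_ring :: "nat \<Rightarrow> (nat \<Rightarrow> nat) \<Rightarrow> 'k::field poly set" where
  "semigroup_ring m d = {f. \<forall>s. coeff f s \<noteq> 0 \<longrightarrow> s \<in> generated_semigroup d {1..m}}"

definition augmentation :: "nat \<Rightarrow> (nat \<Rightarrow> nat) \<Rightarrow> 'k::field mpoly \<Rightarrow> 'k poly" where
  "augmentation m d p = (\<Sum>t\<in>Poly_Mapping.keys p. monom (Poly_Mapping.lookup p t) (weighted_degree m d t))"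

text \<open>
  Elements of a free module of rank \<open>b\<close> are coordinate vectors indexed by
  \<open>{1..b}\<close>, extended by zero. A homomorphism between free modules of ranks
  \<open>b\<close> and \<open>c\<close> is given by a matrix \<open>A\<close>, where \<open>A j r\<close>
  is the \<open>r\<close>-th coordinate of the image of the \<open>j\<close>-th basis element.
\<close>

definition free_module :: "nat \<Rightarrow> nat \<Rightarrow> (nat \<Rightarrow> 'k::field mpoly) set" where
  "free_module m b =
     {v. (\<forall>j\<in>{1..b}. v j \<in> polynomial_ring m) \<and> (\<forall>j. j \<notin> {1..b} \<longrightarrow> v j = 0)}"

definition matrix_map ::
  "nat \<Rightarrow> nat \<Rightarrow> (nat \<Rightarrow> nat \<Rightarrow> 'k::field mpoly) \<Rightarrow> (nat \<Rightarrow> 'k mpoly) \<Rightarrow> nat \<Rightarrow> 'k mpoly" where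
  "matrix_map b c A v = (\<lambda>r. if r \<in> {1..c} then \<Sum>j=1..b. v j * A j r else 0)"

text \<open>
  A minimal graded free resolution
  \<open>0 \<rightarrow> F\<^bsub>m-1\<^esub> \<rightarrow> \<dots> \<rightarrow> F\<^sub>1 \<rightarrow> F\<^sub>0 \<rightarrow> k[S] \<rightarrow> 0\<close>
  of the semigroup ring over the polynomial ring \<open>R\<close>. Here \<open>F\<^sub>0 = R\<close>, the
  module \<open>F\<^sub>i\<close> has rank \<open>b i\<close> with basis elements of degrees
  \<open>D 1 i, \<dots>, D (b i) i\<close>, and \<open>A i\<close> is the matrix of the map from
  \<open>F\<^sub>i\<close> to \<open>F\<^bsub>i-1\<^esub>\<close>. The maps preserve degrees, and minimality
  says that no matrix entry has a nonzero constant term. The length bound is the projective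
  dimension \<open>m - 1\<close> of the semigroup ring.
\<close>

definition minimal_free_resolution ::
  "nat \<Rightarrow> (nat \<Rightarrow> nat) \<Rightarrow> (nat \<Rightarrow> nat) \<Rightarrow> (nat \<Rightarrow> nat \<Rightarrow> nat) \<Rightarrow>
   (nat \<Rightarrow> nat \<Rightarrow> nat \<Rightarrow> 'k::field mpoly) \<Rightarrow> bool" where
  "minimal_free_resolution m d b D A \<longleftrightarrow>
     b 0 = 1 \<and> D 1 0 = 0 \<and>
     (\<forall>i\<in>{1..m-1}. \<forall>j\<in>{1..b i}. \<forall>r\<in>{1..b (i-1)}.
        A i j r \<in> polynomial_ring m \<and>
        (\<forall>t\<in>Poly_Mapping.keys (A i j r). weighted_degree m d t + D r (i-1) = D j i) \<and>
        Poly_Mapping.lookup (A i j r) 0 = 0) \<and>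
     augmentation m d ` polynomial_ring m = (semigroup_ring m d :: 'k poly set) \<and>
     matrix_map (b 1) (b 0) (A 1) ` free_module m (b 1) =
       {v \<in> free_module m (b 0). augmentation m d (v 1) = 0} \<and>
     (\<forall>i\<in>{1..<m-1}.
        matrix_map (b (i+1)) (b i) (A (i+1)) ` free_module m (b (i+1)) =
          {v \<in> free_module m (b i). matrix_map (b i) (b (i-1)) (A i) v = (\<lambda>_. 0)}) \<and>
     {v \<in> free_module m (b (m-1)).
        matrix_map (b (m-1)) (b (m-2)) (A (m-1)) v = (\<lambda>_. 0)} = {\<lambda>_. 0}"

definition degree_mset :: "(nat \<Rightarrow> nat) \<Rightarrow> (nat \<Rightarrow> nat \<Rightarrow> nat) \<Rightarrow> nat \<Rightarrow> nat multiset" where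
  "degree_mset b D i = image_mset (\<lambda>j. D j i) (mset_set {1..b i})"

text \<open>
  The degrees \<open>C 1 i, \<dots>, C (\<beta> i) i\<close>, listed in nondecreasing order, are what remains of
  the degrees \<open>D\<close> in a resolution once equal degrees have been cancelled in pairs between an
  odd and an even index \<open>i\<close>: these are the terms entering the numerator of the Hilbert
  series with opposite signs. The last clause says that no further cancellation is possible.
  If nothing cancels in the resolution, then \<open>C\<close> is just \<open>D\<close>, sorted.
\<close>

definition cancelled_degrees ::
  "nat \<Rightarrow> (nat \<Rightarrow> nat) \<Rightarrow> (nat \<Rightarrow> nat \<Rightarrow> nat) \<Rightarrow> (nat \<Rightarrow> nat) \<Rightarrow> (nat \<Rightarrow> nat \<Rightarrow> nat) \<Rightarrow> bool" where
  "cancelled_degrees m b D \<beta> C \<longleftrightarrow>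
     (\<forall>i\<in>{1..m-1}. mono_on {1..\<beta> i} (\<lambda>j. C j i)) \<and>
     (\<forall>i\<in>{1..m-1}. degree_mset \<beta> C i \<subseteq># degree_mset b D i) \<and>
     (\<Sum>i | i \<in> {1..m-1} \<and> odd i. degree_mset b D i - degree_mset \<beta> C i) =
       (\<Sum>i | i \<in> {1..m-1} \<and> even i. degree_mset b D i - degree_mset \<beta> C i) \<and>
     (\<forall>i\<in>{1..m-1}. \<forall>k\<in>{1..(m - i) div 2}.
        \<forall>j\<in>{1..\<beta> i}. \<forall>r\<in>{1..\<beta> (i + 2*k - 1)}. C j i \<noteq> C r (i + 2*k - 1))"

end

theory Submission
  imports Defs "HOL-Library.Function_Algebras" "HOL-Computational_Algebra.Polynomial_FPS"
    "HOL-Analysis.Complex_Transcendental"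
begin

text \<open>
  Let \<open>\<omega> = exp (2 \<pi> i n / d\<^sub>k)\<close> and let \<open>Q\<close> be the alternating sum of the
  \<open>z\<close>-powers of all degrees in the resolution, the summand \<open>1\<close> from \<open>F\<^sub>0\<close>
  included. Pairs of equal degrees that cancel in \<open>Q\<close> do not change it
  (\<open>cancelled_degrees_alternating_sum\<close>), so the claim is \<open>Q(\<omega>) = 0\<close>.

  Each graded piece of the resolution is an exact complex of finite-dimensional vector spaces,
  so its Euler characteristic is the dimension of the corresponding piece of the semigroup ring,
  which is \<open>1\<close> or \<open>0\<close> (\<open>resolution_euler_characteristic\<close>). Monomials are counted
  by the product of the series \<open>1 / (1 - z^d\<^sub>i)\<close>, and summing over all degrees gives
  \<open>Q = H \<Prod>\<^sub>i (1 - z^d\<^sub>i)\<close> as formal power series, where \<open>H\<close> is the Hilbert series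
  of the semigroup (\<open>k_polynomial_hilbert_series\<close>).

  The factor \<open>1 - z^d\<^sub>k\<close> vanishes at \<open>\<omega>\<close>, but the series \<open>H\<close> diverges on the unit
  circle, so the evaluation has to be done with polynomials. For every generator \<open>d\<^sub>i\<close> the
  product \<open>P\<^sub>i = H (1 - z^d\<^sub>i)\<close> is a polynomial, because at most one element of each
  residue class modulo \<open>d\<^sub>i\<close> survives. Since the generators have gcd \<open>1\<close>, some \<open>d\<^sub>l\<close>
  satisfies \<open>\<omega>^d\<^sub>l \<noteq> 1\<close>. Evaluating \<open>P\<^sub>l (1 - z^d\<^sub>k) = P\<^sub>k (1 - z^d\<^sub>l)\<close> at
  \<open>\<omega>\<close> yields \<open>P\<^sub>k(\<omega>) = 0\<close>, and \<open>P\<^sub>k\<close> divides \<open>Q\<close>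
  (\<open>hilbert_numerator_root\<close>).
\<close>

section \<open>Rank and nullity on finitely spanned subspaces\<close>

context vector_space_pair
begin

text \<open>
  The ambient space of vectors of polynomials is infinite-dimensional, so rank and nullity are
  compared on a finitely spanned subspace: a basis of the kernel is extended to a basis of
  \<open>V\<close>, and the added vectors are mapped bijectively to a basis of the image.
\<close>

lemma rank_nullity_subspace:
  assumes f: "Vector_Spaces.linear s1 s2 f" and V: "vs1.subspace V" and fin: "finite W" "V \<subseteq> vs1.span W"
  shows "vs1.dim V = vs1.dim {v\<in>V. f v = 0} + vs2.dim (f ` V)"
proof -
  interpret f: Vector_Spaces.linear s1 s2 f by (rule f)
  define K where "K = {v\<in>V. f v = 0}"
  obtain B0 where B0: "B0 \<subseteq> K" "vs1.independent B0" "K \<subseteq> vs1.span B0" "card B0 = vs1.dim K"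
    using vs1.basis_exists[of K] by blast
  have "B0 \<subseteq> V" using B0 by (auto simp: K_def)
  then obtain B where B: "B0 \<subseteq> B" "B \<subseteq> V" "vs1.independent B" "V \<subseteq> vs1.span B"
    using vs1.maximal_independent_subset_extend[of B0 V] B0 by blast
  have finB: "finite B"
    using vs1.independent_span_bound[OF fin(1) B(3)] B(2) fin(2) by blast
  have finB0: "finite B0" using finB B by (blast intro: finite_subset)
  define E where "E = B - B0"
  have finE: "finite E" using finB by (simp add: E_def)
  have BE: "B = E \<union> B0" using B by (auto simp: E_def)
  have EV: "vs1.span E \<subseteq> V" using V B(2) by (intro vs1.span_minimal) (auto simp: E_def)
  have triv: "x = 0" if x: "x \<in> vs1.span E" "f x = 0" for x
  proof -
    have "x \<in> vs1.span B0" using x EV B0(3) by (auto simp: K_def)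
    then obtain w where w: "x = (\<Sum>v\<in>B0. s1 (w v) v)"
      using vs1.span_finite[OF finB0] by auto
    obtain u where u: "x = (\<Sum>v\<in>E. s1 (u v) v)"
      using x vs1.span_finite[OF finE] by auto
    \<comment> \<open>The difference of the two expansions of \<open>x\<close> is a linear relation in the basis \<open>B\<close>.\<close>
    define c where "c v = (if v \<in> E then u v else - w v)" for v
    have "(\<Sum>v\<in>B. s1 (c v) v) = (\<Sum>v\<in>E. s1 (c v) v) + (\<Sum>v\<in>B0. s1 (c v) v)"
      unfolding BE by (intro sum.union_disjoint finE finB0) (auto simp: E_def)
    also have "(\<Sum>v\<in>E. s1 (c v) v) = x" unfolding u by (intro sum.cong) (auto simp: c_def)
    also have "(\<Sum>v\<in>B0. s1 (c v) v) = - x" unfolding w sum_negf[symmetric]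
      by (intro sum.cong) (auto simp: c_def E_def)
    finally have "(\<Sum>v\<in>B. s1 (c v) v) = 0" by simp
    hence "c v = 0" if "v \<in> B" for v
      using vs1.independentD[OF B(3) finB subset_refl] that by blast
    hence "u v = 0" if "v \<in> E" for v using that by (metis BE Un_iff c_def)
    thus "x = 0" unfolding u by (intro sum.neutral) auto
  qed
  have inj: "inj_on f (vs1.span E)"
    by (rule inj_onI) (metis f.diff right_minus_eq triv vs1.span_diff)
  have indE: "vs1.independent E" using B(3) by (rule vs1.independent_mono) (auto simp: E_def)
  have "vs2.independent (f ` E)" using f.independent_injective_image[OF indE inj] .
  moreover have "f ` V \<subseteq> vs2.span (f ` E)"
  proof
    fix y assume "y \<in> f ` V"
    then obtain v where v: "v \<in> V" "y = f v" by auto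
    hence "v \<in> vs1.span (E \<union> B0)" using B BE by auto
    then obtain e k where ek: "v = e + k" "e \<in> vs1.span E" "k \<in> vs1.span B0"
      unfolding vs1.span_Un by auto
    have "f k = 0"
      by (rule vs1.span_induct[OF ek(3), of "\<lambda>k. f k = 0"])
        (use B0(1) in \<open>auto simp: K_def f.subspace_kernel\<close>)
    thus "y \<in> vs2.span (f ` E)" using ek v by (auto simp: f.add f.span_image)
  qed
  moreover have "f ` E \<subseteq> f ` V" using B by (auto simp: E_def)
  ultimately have "vs2.dim (f ` V) = card (f ` E)"
    using vs2.basis_card_eq_dim[of "f ` E" "f ` V"] by auto
  also have "\<dots> = card E"
    by (rule card_image) (rule inj_on_subset[OF inj vs1.span_superset])
  finally have "vs2.dim (f ` V) = card E" .
  moreover have "card B = card E + card B0"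
    unfolding BE using finE finB0 by (intro card_Un_disjoint) (auto simp: E_def)
  moreover have "card B = vs1.dim V"
    using vs1.basis_card_eq_dim B by blast
  ultimately show ?thesis using B0 by (simp add: K_def)
qed

end

section \<open>Counting monomials by weighted degree\<close>

definition monomials :: "nat set \<Rightarrow> (nat \<Rightarrow> nat) \<Rightarrow> nat \<Rightarrow> (nat \<Rightarrow>\<^sub>0 nat) set" where
  "monomials I d w = {t. Poly_Mapping.keys t \<subseteq> I \<and> (\<Sum>i\<in>I. Poly_Mapping.lookup t i * d i) = w}"

lemma finite_monomials:
  assumes "finite I" "\<forall>i\<in>I. 0 < d i"
  shows "finite (monomials I d w)"
proof -
  have "Poly_Mapping.lookup t i \<le> w" if t: "t \<in> monomials I d w" and i: "i \<in> I" for t i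
  proof -
    have "Poly_Mapping.lookup t i \<le> Poly_Mapping.lookup t i * d i" using assms i by auto
    also have "\<dots> \<le> (\<Sum>i\<in>I. Poly_Mapping.lookup t i * d i)"
      using assms i by (intro member_le_sum) auto
    finally show ?thesis using t by (simp add: monomials_def)
  qed
  hence "Poly_Mapping.lookup ` monomials I d w \<subseteq>
      {f. \<forall>x. (x \<in> I \<longrightarrow> f x \<in> {..w}) \<and> (x \<notin> I \<longrightarrow> f x = 0)}"
    by (auto simp: monomials_def in_keys_iff)
  moreover have "finite {f. \<forall>x. (x \<in> I \<longrightarrow> f x \<in> {..w}) \<and> (x \<notin> I \<longrightarrow> f x = (0::nat))}"
    by (rule finite_set_of_finite_funs) (use assms in auto)
  ultimately have "finite (Poly_Mapping.lookup ` monomials I d w)" by (rule finite_subset)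
  thus ?thesis by (rule finite_imageD) (meson inj_onI poly_mapping_eq_iff)
qed

text \<open>
  A monomial either omits the variable \<open>x\<^sub>i\<close> or is \<open>x\<^sub>i\<close> times a unique monomial whose
  degree is lower by \<open>d i\<close>.
\<close>

lemma card_monomials_insert:
  assumes I: "finite I" "i \<notin> I" and d: "\<forall>j\<in>insert i I. 0 < d j"
  shows "card (monomials (insert i I) d w) = card (monomials I d w) +
    (if d i \<le> w then card (monomials (insert i I) d (w - d i)) else 0)"
proof -
  let ?x = "Poly_Mapping.single i (1::nat)"
  let ?M = "monomials (insert i I) d"
  define Y where "Y = {t \<in> ?M w. Poly_Mapping.lookup t i \<noteq> 0}"
  have fin: "finite (?M v)" for v using assms by (intro finite_monomials) auto
  have shift: "t + ?x \<in> ?M (v + d i)" if "t \<in> ?M v" for t v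
  proof -
    have "(\<Sum>j\<in>I. Poly_Mapping.lookup (t + ?x) j * d j) = (\<Sum>j\<in>I. Poly_Mapping.lookup t j * d j)"
      using I by (intro sum.cong) (auto simp: lookup_add lookup_single when_def)
    thus ?thesis using that I Poly_Mapping.keys_add[of t ?x]
      by (auto simp: monomials_def lookup_add algebra_simps)
  qed
  have zero: "{t \<in> ?M w. Poly_Mapping.lookup t i = 0} = monomials I d w"
    using I by (auto simp: monomials_def in_keys_iff)
  have "card Y = (if d i \<le> w then card (?M (w - d i)) else 0)"
  proof (cases "d i \<le> w")
    case True
    have "Y = (\<lambda>t. t + ?x) ` ?M (w - d i)"
    proof (intro equalityI subsetI)
      fix t assume t: "t \<in> Y"
      have e: "t = (t - ?x) + ?x"
        using t by (intro poly_mapping_eqI)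
          (auto simp: Y_def lookup_add lookup_minus lookup_single when_def)
      have k: "Poly_Mapping.keys (t - ?x) \<subseteq> insert i I"
        using t by (auto simp: Y_def monomials_def in_keys_iff lookup_minus subset_iff)
      then have "t - ?x \<in> ?M (\<Sum>j\<in>insert i I. Poly_Mapping.lookup (t - ?x) j * d j)"
        by (simp add: monomials_def)
      from shift[OF this] e t
      have "(\<Sum>j\<in>insert i I. Poly_Mapping.lookup (t - ?x) j * d j) + d i = w"
        by (auto simp: Y_def monomials_def)
      hence "t - ?x \<in> ?M (w - d i)" using k by (auto simp: monomials_def)
      thus "t \<in> (\<lambda>t. t + ?x) ` ?M (w - d i)" using e by blast
    next
      fix t assume "t \<in> (\<lambda>t. t + ?x) ` ?M (w - d i)"
      thus "t \<in> Y" using shift[of _ "w - d i"] True by (auto simp: Y_def lookup_add)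
    qed
    moreover have "inj_on (\<lambda>t. t + ?x) (?M (w - d i))" by (auto simp: inj_on_def)
    ultimately show ?thesis using True by (simp add: card_image)
  next
    case False
    have "d i \<le> w" if "t \<in> Y" for t
    proof -
      have "d i \<le> Poly_Mapping.lookup t i * d i" using that by (auto simp: Y_def)
      also have "\<dots> \<le> w" using that I by (auto simp: Y_def monomials_def)
      finally show ?thesis .
    qed
    hence "Y = {}" using False by auto
    thus ?thesis using False by simp
  qed
  moreover have "card (?M w) = card ({t \<in> ?M w. Poly_Mapping.lookup t i = 0} \<union> Y)"
    by (rule arg_cong[of _ _ card]) (auto simp: Y_def)
  hence "card (?M w) = card {t \<in> ?M w. Poly_Mapping.lookup t i = 0} + card Y"
    by (subst (asm) card_Un_disjoint) (auto simp: fin Y_def)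
  ultimately show ?thesis by (simp add: zero)
qed

text \<open>
  Coefficientwise, multiplication by \<open>1 - z^(d i)\<close> is the recursion of
  \<open>card_monomials_insert\<close>, so each factor removes one variable.
\<close>

lemma monomials_generating_function:
  assumes "finite I" "\<forall>i\<in>I. 0 < d i"
  shows "Abs_fps (\<lambda>w. of_nat (card (monomials I d w))) * (\<Prod>i\<in>I. 1 - fps_X ^ d i) =
    (1 :: 'a::comm_ring_1 fps)"
  using assms
proof (induction I rule: finite_induct)
  case empty
  have "monomials {} d w = (if w = 0 then {0} else {})" for w
    by (auto simp: monomials_def)
  thus ?case by (auto simp: fps_eq_iff)
next
  case (insert i I)
  let ?N = "\<lambda>I. Abs_fps (\<lambda>w. of_nat (card (monomials I d w))) :: 'a fps"
  have "?N (insert i I) * (1 - fps_X ^ d i) = ?N I"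
  proof (rule fps_ext)
    fix w
    show "fps_nth (?N (insert i I) * (1 - fps_X ^ d i)) w = fps_nth (?N I) w"
      using card_monomials_insert[of I i d w] insert.hyps insert.prems
      by (simp add: right_diff_distrib fps_X_power_mult_right_nth)
  qed
  thus ?case using insert by (simp add: mult.assoc[symmetric])
qed

section \<open>Apery polynomials and roots of unity\<close>

definition hilbert_series :: "nat set \<Rightarrow> complex fps" where
  "hilbert_series S = Abs_fps (\<lambda>s. if s \<in> S then 1 else 0)"

text \<open>
  The coefficients of the product are the indicator of \<open>S \<setminus> (S + a)\<close>, the Apery set of
  \<open>S\<close>. Two of its elements cannot be congruent modulo \<open>a\<close>: subtracting \<open>a\<close> from the
  larger one would leave an element of \<open>S\<close>. Hence the Apery set is finite.
\<close>

lemma hilbert_series_apery: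
  assumes a: "0 < a" and S: "\<And>s. s \<in> S \<Longrightarrow> s + a \<in> S"
  shows "\<exists>P. hilbert_series S * (1 - fps_X ^ a) = fps_of_poly P"
proof -
  define F where "F = {n \<in> S. \<not> (a \<le> n \<and> n - a \<in> S)}"
  have iter: "s + q * a \<in> S" if "s \<in> S" for s q
  proof (induction q)
    case (Suc q)
    thus ?case using S[OF Suc] by (simp add: algebra_simps)
  qed (use that in simp)
  have less: "\<not> x < y" if xy: "x \<in> F" "y \<in> F" "x mod a = y mod a" for x y
  proof
    assume "x < y"
    moreover from this obtain q where q: "y = x + q * a"
      using xy(3) by (metis mod_eq_nat2E nat_less_le mult.commute)
    ultimately obtain q' where "q = Suc q'" by (cases q) auto
    hence "y - a = x + q' * a" "a \<le> y" using q by auto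
    thus False using xy iter[of x q'] by (auto simp: F_def)
  qed
  have "inj_on (\<lambda>x. x mod a) F"
    using less by (intro inj_onI) (metis linorder_neqE_nat)
  moreover have "finite ((\<lambda>x. x mod a) ` F)"
    by (rule finite_subset[of _ "{..<a}"]) (use a in auto)
  ultimately have fin: "finite F" by (rule finite_imageD[rotated])
  have "n \<in> S" if "a \<le> n" "n - a \<in> S" for n using S[OF that(2)] that(1) by simp
  hence "fps_nth (hilbert_series S * (1 - fps_X ^ a)) n = (if n \<in> F then 1 else 0)" for n
    by (auto simp: right_diff_distrib fps_X_power_mult_right_nth hilbert_series_def F_def)
  moreover have "coeff (\<Sum>n\<in>F. monom 1 n) n = (if n \<in> F then 1 else (0::complex))" for n
    using fin by (simp add: coeff_sum)
  ultimately have "hilbert_series S * (1 - fps_X ^ a) = fps_of_poly (\<Sum>n\<in>F. monom 1 n)"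
    by (intro fps_ext) simp
  thus ?thesis by blast
qed

lemma generated_semigroup_add_generator:
  assumes "finite I" "i \<in> I" "s \<in> generated_semigroup d I"
  shows "s + d i \<in> generated_semigroup d I"
proof -
  from assms(3) obtain x where x: "s = (\<Sum>j\<in>I. x j * d j)" by (auto simp: generated_semigroup_def)
  have "s + d i = (\<Sum>j\<in>I. (x(i := x i + 1)) j * d j)"
    using assms(1,2) by (simp add: x sum.remove[of I i] cong: if_cong)
  thus ?thesis unfolding generated_semigroup_def by blast
qed

text \<open>
  Two expressions of \<open>H\<close> as a fraction are played against each other: with
  \<open>H = P k / (1 - z^(d k)) = P l / (1 - z^(d l))\<close>, only the first denominator vanishes at
  \<open>\<omega>\<close>, so its numerator must vanish there as well.
\<close>

lemma hilbert_numerator_root: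
  fixes d :: "nat \<Rightarrow> nat" and I :: "nat set" and Q :: "complex poly"
  defines "H \<equiv> hilbert_series (generated_semigroup d I)"
  assumes I: "finite I" "\<forall>i\<in>I. 0 < d i"
    and Q: "fps_of_poly Q = H * (\<Prod>i\<in>I. 1 - fps_X ^ d i)"
    and k: "k \<in> I" "\<omega> ^ d k = 1" and l: "l \<in> I" "\<omega> ^ d l \<noteq> 1"
  shows "poly Q \<omega> = 0"
proof -
  have "\<exists>P. H * (1 - fps_X ^ d i) = fps_of_poly P" if "i \<in> I" for i
    unfolding H_def using I that
    by (intro hilbert_series_apery generated_semigroup_add_generator) auto
  then obtain P where P: "\<And>i. i \<in> I \<Longrightarrow> H * (1 - fps_X ^ d i) = fps_of_poly (P i)" by metis
  have fps: "fps_of_poly (1 - monom 1 a) = 1 - (fps_X :: complex fps) ^ a" for a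
    by (simp add: fps_of_poly_diff fps_of_poly_monom')
  have "fps_of_poly (P l * (1 - monom 1 (d k))) = fps_of_poly (P k * (1 - monom 1 (d l)))"
    unfolding fps_of_poly_mult fps P[OF k(1), symmetric] P[OF l(1), symmetric]
    by (simp add: mult_ac)
  hence "P l * (1 - monom 1 (d k)) = P k * (1 - monom 1 (d l))"
    by (simp only: fps_of_poly_eq_iff)
  from arg_cong[OF this, of "\<lambda>p. poly p \<omega>"] have "poly (P k) \<omega> = 0"
    using k l by (simp add: poly_monom)
  moreover have "fps_of_poly Q = fps_of_poly (P k * (\<Prod>i\<in>I - {k}. 1 - monom 1 (d i)))"
    unfolding Q fps_of_poly_mult fps_of_poly_prod fps P[OF k(1), symmetric]
    using I k by (simp add: prod.remove[of I k] mult_ac)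
  hence "Q = P k * (\<Prod>i\<in>I - {k}. 1 - monom 1 (d i))" by (simp only: fps_of_poly_eq_iff)
  ultimately show ?thesis by simp
qed

text \<open>
  As \<open>n\<close> is prime to \<open>d k\<close>, the root \<open>\<omega>\<close> has order exactly \<open>d k\<close>. If
  \<open>\<omega> ^ d l = 1\<close> for all \<open>l\<close>, then \<open>d k\<close> would divide the gcd of all generators.
\<close>

lemma root_of_unity_generator:
  fixes d :: "nat \<Rightarrow> nat" and I :: "nat set" and k :: nat and n :: int
  assumes Gcd: "Gcd (d ` I) = 1" and k: "k \<in> I" and n: "gcd n (int (d k)) = 1" "1 < d k"
  defines "\<omega> \<equiv> exp (\<i> * complex_of_real (2 * pi * of_int n / of_nat (d k)))"
  shows "\<omega> ^ d k = 1" and "\<exists>l\<in>I. \<omega> ^ d l \<noteq> 1"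
proof -
  have pow: "\<omega> ^ a = exp (complex_of_real (2 * pi * (of_int n * of_nat a / of_nat (d k))) * \<i>)" for a
    unfolding \<omega>_def exp_of_nat_mult[symmetric] by (simp add: field_simps)
  \<comment> \<open>The argument is kept as a real factor times \<open>\<i>\<close> to match the criterion for \<open>exp z = 1\<close>.\<close>
  have re_im: "Re (complex_of_real x * \<i>) = 0" "Im (complex_of_real x * \<i>) = x" for x
    by simp_all
  have cancel: "2 * pi * x = of_int (2 * q) * pi \<longleftrightarrow> x = of_int q" for x and q :: int
    by auto
  have iff: "\<omega> ^ a = 1 \<longleftrightarrow> d k dvd a" for a
  proof -
    have "\<omega> ^ a = 1 \<longleftrightarrow> (\<exists>q::int. 2 * pi * (of_int n * of_nat a / of_nat (d k)) = of_int (2 * q) * pi)"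
      unfolding pow exp_eq_1 re_im by simp
    also have "\<dots> \<longleftrightarrow> (\<exists>q::int. n * int a = q * int (d k))"
    proof -
      have "2 * pi * (of_int n * of_nat a / of_nat (d k)) = of_int (2 * q) * pi \<longleftrightarrow>
          n * int a = q * int (d k)" for q :: int
      proof -
        have "2 * pi * (of_int n * of_nat a / of_nat (d k)) = of_int (2 * q) * pi \<longleftrightarrow>
          of_int n * of_nat a / of_nat (d k) = (of_int q :: real)"
          by (rule cancel)
        also have "\<dots> \<longleftrightarrow> real_of_int (n * int a) = of_int (q * int (d k))"
          using n by (simp add: field_simps)
        also have "\<dots> \<longleftrightarrow> n * int a = q * int (d k)" by (simp only: of_int_eq_iff)
        finally show ?thesis .
      qed
      thus ?thesis by simp
    qed
    also have "\<dots> \<longleftrightarrow> int (d k) dvd n * int a" by (auto simp: dvd_def mult.commute)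
    also have "\<dots> \<longleftrightarrow> int (d k) dvd int a"
      using n(1) by (intro coprime_dvd_mult_right_iff) (simp add: coprime_iff_gcd_eq_1 gcd.commute)
    finally show ?thesis by simp
  qed
  show "\<omega> ^ d k = 1" by (simp add: iff)
  show "\<exists>l\<in>I. \<omega> ^ d l \<noteq> 1"
  proof (rule ccontr)
    assume "\<not> ?thesis"
    hence "d k dvd Gcd (d ` I)" by (auto simp: iff intro!: Gcd_greatest)
    thus False using Gcd n by simp
  qed
qed

section \<open>Homogeneous elements of graded free modules\<close>

definition restrict_monomials :: "((nat \<Rightarrow>\<^sub>0 nat) \<Rightarrow> bool) \<Rightarrow> 'k::field mpoly \<Rightarrow> 'k mpoly" where
  "restrict_monomials P p =
    (\<Sum>t\<in>{t\<in>Poly_Mapping.keys p. P t}. Poly_Mapping.single t (Poly_Mapping.lookup p t))"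

lemma lookup_restrict_monomials:
  "Poly_Mapping.lookup (restrict_monomials P p) t = (if P t then Poly_Mapping.lookup p t else 0)"
  by (auto simp: restrict_monomials_def lookup_sum lookup_single when_def in_keys_iff)

lemma keys_restrict_monomials:
  "Poly_Mapping.keys (restrict_monomials P p) = {t\<in>Poly_Mapping.keys p. P t}"
  by (auto simp: in_keys_iff lookup_restrict_monomials split: if_splits)

lemma restrict_monomials_0 [simp]: "restrict_monomials P 0 = 0"
  by (simp add: restrict_monomials_def)

lemma restrict_monomials_sum:
  "restrict_monomials P (\<Sum>j\<in>J. f j) = (\<Sum>j\<in>J. restrict_monomials P (f j))"
  by (intro poly_mapping_eqI) (simp add: lookup_restrict_monomials lookup_sum)

lemma restrict_monomials_id_iff:
  "restrict_monomials P p = p \<longleftrightarrow> (\<forall>t\<in>Poly_Mapping.keys p. P t)"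
  unfolding poly_mapping_eq_iff fun_eq_iff lookup_restrict_monomials Ball_def in_keys_iff
  by auto

text \<open>
  If multiplication by the monomials of \<open>q\<close> turns exactly the monomials satisfying \<open>P\<close>
  into monomials satisfying \<open>P'\<close>, then the products of the kept and of the dropped part of
  \<open>p\<close> with \<open>q\<close> have no monomial in common. For homogeneous \<open>q\<close> this says that taking
  homogeneous parts commutes with multiplication by \<open>q\<close>.
\<close>

lemma restrict_monomials_mult:
  assumes "\<And>t u. u \<in> Poly_Mapping.keys q \<Longrightarrow> P' (t + u) \<longleftrightarrow> P t"
  shows "restrict_monomials P' (p * q) = restrict_monomials P p * q"
proof -
  let ?p1 = "restrict_monomials P p" and ?p2 = "restrict_monomials (\<lambda>t. \<not> P t) p"
  have p: "p = ?p1 + ?p2"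
    by (intro poly_mapping_eqI) (simp add: lookup_restrict_monomials lookup_add)
  have 1: "P' t" if "t \<in> Poly_Mapping.keys (?p1 * q)" for t
    using that Poly_Mapping.keys_mult[of ?p1 q] assms by (auto simp: keys_restrict_monomials)
  have 2: "\<not> P' t" if "t \<in> Poly_Mapping.keys (?p2 * q)" for t
    using that Poly_Mapping.keys_mult[of ?p2 q] assms by (auto simp: keys_restrict_monomials)
  have "Poly_Mapping.lookup (?p1 * q) t = 0" if "\<not> P' t" for t
    using that 1 by (auto simp: in_keys_iff)
  moreover have "Poly_Mapping.lookup (?p2 * q) t = 0" if "P' t" for t
    using that 2 by (auto simp: in_keys_iff)
  moreover have pq: "p * q = ?p1 * q + ?p2 * q" by (subst p) (simp only: distrib_right)
  ultimately show ?thesis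
    by (intro poly_mapping_eqI) (simp add: lookup_restrict_monomials pq lookup_add)
qed

text \<open>
  Scalars act through the constant polynomials, so that linearity over \<open>k\<close> of the maps in
  the resolution follows from ring arithmetic.
\<close>

definition scale_vector :: "'k::field \<Rightarrow> (nat \<Rightarrow> 'k mpoly) \<Rightarrow> nat \<Rightarrow> 'k mpoly" where
  "scale_vector c v = (\<lambda>j. Poly_Mapping.single 0 c * v j)"

lemma lookup_single_0_mult:
  "Poly_Mapping.lookup (Poly_Mapping.single 0 c * p) t = c * Poly_Mapping.lookup (p :: 'k::field mpoly) t"
  by (simp add: mult_map_scale_conv_mult[symmetric] Poly_Mapping.map.rep_eq when_def)

lemma keys_single_0_mult_subset:
  "Poly_Mapping.keys (Poly_Mapping.single 0 c * p) \<subseteq> Poly_Mapping.keys (p :: 'k::field mpoly)"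
  by (auto simp: in_keys_iff lookup_single_0_mult)

interpretation vec: vector_space "scale_vector :: 'k::field \<Rightarrow> _"
  by standard
    (auto simp: scale_vector_def fun_eq_iff distrib_left distrib_right single_add
      mult.assoc[symmetric] mult_single)

interpretation pol: vector_space "smult :: 'k::field \<Rightarrow> 'k poly \<Rightarrow> 'k poly"
  by standard (auto simp: smult_add_right smult_add_left)

interpretation vec_vec: vector_space_pair "scale_vector :: 'k::field \<Rightarrow> _" scale_vector ..

interpretation vec_pol: vector_space_pair "scale_vector :: 'k::field \<Rightarrow> _" smult ..

text \<open>
  In the free module whose \<open>j\<close>-th basis element has degree \<open>e j\<close>, this is the component
  of \<open>v\<close> of degree \<open>s\<close>.
\<close>

definition homogeneous_part ::
  "nat \<Rightarrow> (nat \<Rightarrow> nat) \<Rightarrow> (nat \<Rightarrow> nat) \<Rightarrow> nat \<Rightarrow> (nat \<Rightarrow> 'k::field mpoly) \<Rightarrow> nat \<Rightarrow> 'k mpoly" where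
  "homogeneous_part m d e s v =
    (\<lambda>j. restrict_monomials (\<lambda>t. weighted_degree m d t + e j = s) (v j))"

definition graded_piece ::
  "nat \<Rightarrow> (nat \<Rightarrow> nat) \<Rightarrow> nat \<Rightarrow> (nat \<Rightarrow> nat) \<Rightarrow> nat \<Rightarrow> (nat \<Rightarrow> 'k::field mpoly) set" where
  "graded_piece m d b e s = {v \<in> free_module m b. homogeneous_part m d e s v = v}"

lemma graded_piece_iff:
  "v \<in> graded_piece m d b e s \<longleftrightarrow> (\<forall>j. j \<notin> {1..b} \<longrightarrow> v j = 0) \<and>
    (\<forall>j\<in>{1..b}. \<forall>t\<in>Poly_Mapping.keys (v j).
      Poly_Mapping.keys t \<subseteq> {1..m} \<and> weighted_degree m d t + e j = s)"
  (is "?L \<longleftrightarrow> ?Z \<and> ?R")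
proof -
  have "homogeneous_part m d e s v = v \<longleftrightarrow>
      (\<forall>j. \<forall>t\<in>Poly_Mapping.keys (v j). weighted_degree m d t + e j = s)"
    unfolding homogeneous_part_def fun_eq_iff restrict_monomials_id_iff ..
  also have "\<dots> \<longleftrightarrow> (\<forall>j\<in>{1..b}. \<forall>t\<in>Poly_Mapping.keys (v j). weighted_degree m d t + e j = s)" if ?Z
    using that by (metis empty_iff keys_zero)
  finally show ?thesis
    unfolding graded_piece_def free_module_def polynomial_ring_def by blast
qed

lemma weighted_degree_add:
  "weighted_degree m d (t + u) = weighted_degree m d t + weighted_degree m d u"
  by (simp add: weighted_degree_def lookup_add distrib_right sum.distrib)

lemma matrix_map_homogeneous_part:
  assumes "\<And>j r u. j \<in> {1..b} \<Longrightarrow> r \<in> {1..c} \<Longrightarrow> u \<in> Poly_Mapping.keys (A j r) \<Longrightarrow>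
    weighted_degree m d u + e' r = e j"
  shows "matrix_map b c A (homogeneous_part m d e s v) =
    homogeneous_part m d e' s (matrix_map b c A v)"
proof
  fix r
  have "restrict_monomials (\<lambda>t. weighted_degree m d t + e j = s) (v j) * A j r =
      restrict_monomials (\<lambda>t. weighted_degree m d t + e' r = s) (v j * A j r)"
    if "r \<in> {1..c}" "j \<in> {1..b}" for j
    by (rule restrict_monomials_mult[symmetric])
      (simp add: weighted_degree_add add.assoc assms[OF that(2,1)])
  thus "matrix_map b c A (homogeneous_part m d e s v) r =
      homogeneous_part m d e' s (matrix_map b c A v) r"
    by (simp add: matrix_map_def homogeneous_part_def restrict_monomials_sum)
qed

lemma homogeneous_part_in_graded_piece:
  assumes "v \<in> free_module m b"
  shows "homogeneous_part m d e s v \<in> graded_piece m d b e s"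
  using assms unfolding graded_piece_iff
  by (auto simp: homogeneous_part_def keys_restrict_monomials free_module_def polynomial_ring_def)

text \<open>
  Exactness passes to each degree: a preimage of a homogeneous element may be replaced by its
  homogeneous part, because the map commutes with taking homogeneous parts.
\<close>

lemma matrix_map_image_graded_piece:
  assumes deg: "\<And>j r u. j \<in> {1..b} \<Longrightarrow> r \<in> {1..c} \<Longrightarrow> u \<in> Poly_Mapping.keys (A j r) \<Longrightarrow>
      weighted_degree m d u + e' r = e j"
    and exact: "matrix_map b c A ` free_module m b = {v \<in> free_module m c. P v}"
  shows "matrix_map b c A ` graded_piece m d b e s = {v \<in> graded_piece m d c e' s. P v}"
proof -
  have part: "matrix_map b c A (homogeneous_part m d e s v) =
      homogeneous_part m d e' s (matrix_map b c A v)" for v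
    by (rule matrix_map_homogeneous_part) (rule deg)
  show ?thesis
  proof (intro equalityI subsetI)
    fix w assume "w \<in> matrix_map b c A ` graded_piece m d b e s"
    then obtain v where v: "v \<in> free_module m b" "homogeneous_part m d e s v = v"
      and w: "w = matrix_map b c A v"
      by (auto simp: graded_piece_def)
    have "w \<in> {v \<in> free_module m c. P v}" unfolding exact[symmetric] using v w by blast
    moreover have "homogeneous_part m d e' s w = w"
      unfolding w using v(2) by (metis part)
    ultimately show "w \<in> {v \<in> graded_piece m d c e' s. P v}" by (simp add: graded_piece_def)
  next
    fix w assume w: "w \<in> {v \<in> graded_piece m d c e' s. P v}"
    hence "w \<in> {v \<in> free_module m c. P v}" by (simp add: graded_piece_def)
    then obtain u where u: "u \<in> free_module m b" "w = matrix_map b c A u"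
      unfolding exact[symmetric] by blast
    have "matrix_map b c A (homogeneous_part m d e s u) = w"
      using w u by (simp add: graded_piece_def part)
    thus "w \<in> matrix_map b c A ` graded_piece m d b e s"
      using homogeneous_part_in_graded_piece[OF u(1)] by blast
  qed
qed

text \<open>
  The pairs \<open>(j, t)\<close> for which the monomial \<open>t\<close> times the \<open>j\<close>-th basis element lies in the
  graded piece of degree \<open>s\<close>; they index a basis of it over \<open>k\<close>.
\<close>

definition homogeneous_indices ::
  "nat \<Rightarrow> (nat \<Rightarrow> nat) \<Rightarrow> nat \<Rightarrow> (nat \<Rightarrow> nat) \<Rightarrow> nat \<Rightarrow> (nat \<times> (nat \<Rightarrow>\<^sub>0 nat)) set" where
  "homogeneous_indices m d b e s =
    (SIGMA j:{1..b}. {t. Poly_Mapping.keys t \<subseteq> {1..m} \<and> weighted_degree m d t + e j = s})"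

lemma graded_piece_iff_lookup:
  "v \<in> graded_piece m d b e s \<longleftrightarrow>
    (\<forall>j t. (j, t) \<notin> homogeneous_indices m d b e s \<longrightarrow> Poly_Mapping.lookup (v j) t = 0)"
  (is "_ \<longleftrightarrow> ?R")
proof
  assume v: "v \<in> graded_piece m d b e s"
  show ?R
  proof (intro allI impI)
    fix j t assume "(j, t) \<notin> homogeneous_indices m d b e s"
    hence "j \<notin> {1..b} \<or> t \<notin> Poly_Mapping.keys (v j)"
      using v unfolding graded_piece_iff homogeneous_indices_def by blast
    moreover have "j \<notin> {1..b} \<Longrightarrow> v j = 0" using v unfolding graded_piece_iff by blast
    ultimately show "Poly_Mapping.lookup (v j) t = 0"
      unfolding in_keys_iff by (metis lookup_zero)
  qed
next
  assume R: ?R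
  show "v \<in> graded_piece m d b e s"
    unfolding graded_piece_iff
  proof (intro conjI allI impI ballI)
    fix j assume "j \<notin> {1..b}"
    thus "v j = 0" using R by (intro poly_mapping_eqI) (auto simp: homogeneous_indices_def)
  next
    fix j t assume "t \<in> Poly_Mapping.keys (v j)"
    hence "(j, t) \<in> homogeneous_indices m d b e s" using R by (auto simp: in_keys_iff)
    thus "Poly_Mapping.keys t \<subseteq> {1..m}" "weighted_degree m d t + e j = s"
      by (auto simp: homogeneous_indices_def)
  qed
qed

lemma subspace_graded_piece: "vec.subspace (graded_piece m d b e s :: (nat \<Rightarrow> 'k::field mpoly) set)"
  by (rule vec.subspaceI)
    (auto simp: graded_piece_iff_lookup lookup_add scale_vector_def lookup_single_0_mult)

definition monomial_vector :: "nat \<times> (nat \<Rightarrow>\<^sub>0 nat) \<Rightarrow> nat \<Rightarrow> 'k::field mpoly" where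
  "monomial_vector p = (\<lambda>j. if j = fst p then Poly_Mapping.single (snd p) 1 else 0)"

lemma homogeneous_monomials:
  "{t. Poly_Mapping.keys t \<subseteq> {1..m} \<and> weighted_degree m d t + e = s} =
    (if e \<le> s then monomials {1..m} d (s - e) else {})"
  by (auto simp: monomials_def weighted_degree_def)

lemma finite_homogeneous_indices:
  assumes "\<forall>i\<in>{1..m}. 0 < d i"
  shows "finite (homogeneous_indices m d b e s)"
  unfolding homogeneous_indices_def homogeneous_monomials using assms
  by (intro finite_SigmaI) (auto intro: finite_monomials)

lemma sum_fun_apply: "(sum f X) j = (\<Sum>x\<in>X. f x j)"
  by (induction X rule: infinite_finite_induct) auto

text \<open>
  The coefficients of a combination of monomial vectors can be read off, which gives both
  independence and the expansion of a given element.
\<close>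

lemma lookup_sum_monomial_vector:
  fixes c :: "nat \<times> (nat \<Rightarrow>\<^sub>0 nat) \<Rightarrow> 'k::field"
  assumes "finite J"
  shows "Poly_Mapping.lookup ((\<Sum>p\<in>J. scale_vector (c p) (monomial_vector p)) j) t =
    (if (j, t) \<in> J then c (j, t) else 0)"
proof -
  have "Poly_Mapping.lookup ((\<Sum>p\<in>J. scale_vector (c p) (monomial_vector p)) j) t =
      (\<Sum>p\<in>J. if p = (j, t) then c p else 0)"
    unfolding sum_fun_apply lookup_sum
    by (intro sum.cong)
      (auto simp: scale_vector_def monomial_vector_def lookup_single_0_mult lookup_single when_def)
  thus ?thesis using assms by simp
qed

lemma inj_monomial_vector: "inj (monomial_vector :: _ \<Rightarrow> nat \<Rightarrow> 'k::field mpoly)"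
proof (rule injI)
  fix p q assume e: "monomial_vector p = (monomial_vector q :: nat \<Rightarrow> 'k mpoly)"
  have "Poly_Mapping.lookup (monomial_vector p (fst p)) (snd p) = (1 :: 'k)"
    by (simp add: monomial_vector_def)
  hence "Poly_Mapping.lookup (monomial_vector q (fst p)) (snd p) = (1 :: 'k)" by (simp add: e)
  thus "p = q"
    by (auto simp: monomial_vector_def lookup_single when_def prod_eq_iff split: if_splits)
qed

lemma graded_piece_span:
  assumes d: "\<forall>i\<in>{1..m}. 0 < d i"
  shows "(graded_piece m d b e s :: (nat \<Rightarrow> 'k::field mpoly) set) \<subseteq>
    vec.span (monomial_vector ` homogeneous_indices m d b e s)"
proof
  fix v :: "nat \<Rightarrow> 'k mpoly" assume v: "v \<in> graded_piece m d b e s"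
  let ?J = "homogeneous_indices m d b e s"
  have "v = (\<Sum>p\<in>?J. scale_vector (Poly_Mapping.lookup (v (fst p)) (snd p)) (monomial_vector p))"
  proof (intro ext poly_mapping_eqI)
    fix j t
    have "Poly_Mapping.lookup (v j) t = 0" if "(j, t) \<notin> ?J"
      using v that by (simp add: graded_piece_iff_lookup)
    thus "Poly_Mapping.lookup (v j) t = Poly_Mapping.lookup
        ((\<Sum>p\<in>?J. scale_vector (Poly_Mapping.lookup (v (fst p)) (snd p)) (monomial_vector p)) j) t"
      by (auto simp: lookup_sum_monomial_vector[OF finite_homogeneous_indices[OF d]])
  qed
  also have "\<dots> \<in> vec.span (monomial_vector ` ?J)"
    by (intro vec.span_sum vec.span_scale vec.span_base) auto
  finally show "v \<in> vec.span (monomial_vector ` ?J)" .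
qed

lemma dim_graded_piece:
  assumes d: "\<forall>i\<in>{1..m}. 0 < d i"
  shows "vec.dim (graded_piece m d b e s :: (nat \<Rightarrow> 'k::field mpoly) set) =
    (\<Sum>j=1..b. if e j \<le> s then card (monomials {1..m} d (s - e j)) else 0)"
proof -
  let ?J = "homogeneous_indices m d b e s"
  let ?B = "monomial_vector ` ?J :: (nat \<Rightarrow> 'k mpoly) set"
  have fin: "finite ?J" by (rule finite_homogeneous_indices[OF d])
  have inj: "inj_on (monomial_vector :: _ \<Rightarrow> nat \<Rightarrow> 'k mpoly) ?J"
    using inj_monomial_vector by (rule inj_on_subset) simp
  have sub: "?B \<subseteq> graded_piece m d b e s"
    by (auto simp: graded_piece_iff monomial_vector_def homogeneous_indices_def)
  have ind: "vec.independent ?B"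
  proof (rule vec.independent_if_scalars_zero)
    show "finite ?B" using fin by simp
    fix c :: "(nat \<Rightarrow> 'k mpoly) \<Rightarrow> 'k" and x
    assume z: "(\<Sum>x\<in>?B. scale_vector (c x) x) = 0" and x: "x \<in> ?B"
    then obtain p where p: "p \<in> ?J" "x = monomial_vector p" by auto
    have "(\<Sum>p\<in>?J. scale_vector (c (monomial_vector p)) (monomial_vector p)) = 0"
      using z by (simp add: sum.reindex[OF inj])
    hence "Poly_Mapping.lookup ((\<Sum>p\<in>?J. scale_vector (c (monomial_vector p)) (monomial_vector p))
        (fst p)) (snd p) = 0" by simp
    thus "c x = 0"
      using lookup_sum_monomial_vector[OF fin, of "\<lambda>p. c (monomial_vector p)" "fst p" "snd p"] p
      by simp
  qed
  have "vec.dim (graded_piece m d b e s :: (nat \<Rightarrow> 'k mpoly) set) = card ?B"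
    using vec.basis_card_eq_dim[OF sub graded_piece_span[OF d] ind] by simp
  also have "\<dots> = card ?J" by (rule card_image[OF inj])
  also have "\<dots> = (\<Sum>j=1..b. card {t. Poly_Mapping.keys t \<subseteq> {1..m} \<and> weighted_degree m d t + e j = s})"
    unfolding homogeneous_indices_def
    unfolding homogeneous_monomials using d
    by (intro card_SigmaI) (auto intro: finite_monomials)
  also have "\<dots> = (\<Sum>j=1..b. if e j \<le> s then card (monomials {1..m} d (s - e j)) else 0)"
    unfolding homogeneous_monomials by (intro sum.cong) auto
  finally show ?thesis .
qed

lemma linear_matrix_map: "Vector_Spaces.linear scale_vector scale_vector (matrix_map b c A)"
  unfolding Vector_Spaces.linear_iff
  by (auto simp: matrix_map_def scale_vector_def fun_eq_iff distrib_right sum.distrib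
      sum_distrib_left mult.assoc intro: vec.vector_space_axioms)

lemma augmentation_superset:
  assumes "finite X" "Poly_Mapping.keys p \<subseteq> X"
  shows "augmentation m d p = (\<Sum>t\<in>X. monom (Poly_Mapping.lookup p t) (weighted_degree m d t))"
  unfolding augmentation_def using assms by (intro sum.mono_neutral_left) (auto simp: in_keys_iff)

lemma linear_augmentation:
  "Vector_Spaces.linear scale_vector smult (\<lambda>v :: nat \<Rightarrow> 'k::field mpoly. augmentation m d (v 1))"
proof -
  have add: "augmentation m d (p + q) = augmentation m d p + augmentation m d q" for p q :: "'k mpoly"
  proof -
    let ?X = "Poly_Mapping.keys p \<union> Poly_Mapping.keys q"
    have "augmentation m d r = (\<Sum>t\<in>?X. monom (Poly_Mapping.lookup r t) (weighted_degree m d t))"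
      if "r \<in> {p, q, p + q}" for r
      using that Poly_Mapping.keys_add[of p q] by (intro augmentation_superset) auto
    thus ?thesis by (simp add: lookup_add add_monom[symmetric] sum.distrib)
  qed
  have "augmentation m d (Poly_Mapping.single 0 c * p) = smult c (augmentation m d p)"
    for c and p :: "'k mpoly"
    unfolding augmentation_superset[OF finite_keys keys_single_0_mult_subset[of c p]]
    by (simp add: lookup_single_0_mult augmentation_def pol.scale_sum_right smult_monom)
  thus ?thesis unfolding Vector_Spaces.linear_iff
    by (auto simp: add scale_vector_def intro: vec.vector_space_axioms pol.vector_space_axioms)
qed

lemma weighted_degree_in_semigroup: "weighted_degree m d t \<in> generated_semigroup d {1..m}"
  by (auto simp: weighted_degree_def generated_semigroup_def)

lemma generated_semigroup_monomial:
  assumes "s \<in> generated_semigroup d {1..m}"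
  shows "\<exists>t. Poly_Mapping.keys t \<subseteq> {1..m} \<and> weighted_degree m d t = s"
proof -
  obtain x where x: "s = (\<Sum>i=1..m. x i * d i)" using assms by (auto simp: generated_semigroup_def)
  let ?t = "\<Sum>i=1..m. Poly_Mapping.single i (x i)"
  have "Poly_Mapping.lookup ?t i = (if i \<in> {1..m} then x i else 0)" for i
    by (auto simp: lookup_sum lookup_single when_def)
  thus ?thesis using x by (intro exI[of _ ?t]) (auto simp: weighted_degree_def in_keys_iff split: if_splits)
qed

text \<open>
  In degree \<open>s\<close> the semigroup ring is spanned by \<open>z^s\<close> or is zero, according to whether
  \<open>s\<close> is the weighted degree of some monomial.
\<close>

lemma dim_augmentation_image:
  assumes "e 1 = 0"
  shows "pol.dim ((\<lambda>v. augmentation m d (v 1)) `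
      (graded_piece m d 1 e s :: (nat \<Rightarrow> 'k::field mpoly) set)) =
    (if s \<in> generated_semigroup d {1..m} then 1 else 0)"
proof -
  define B :: "'k poly set" where
    "B = (if s \<in> generated_semigroup d {1..m} then {monom 1 s} else {})"
  let ?V = "(\<lambda>v. augmentation m d (v 1)) ` (graded_piece m d 1 e s :: (nat \<Rightarrow> 'k mpoly) set)"
  have sub: "?V \<subseteq> pol.span B"
  proof (rule image_subsetI)
    fix v :: "nat \<Rightarrow> 'k mpoly" assume v: "v \<in> graded_piece m d 1 e s"
    have deg: "weighted_degree m d t = s" if "t \<in> Poly_Mapping.keys (v 1)" for t
      using v that assms by (auto simp: graded_piece_iff)
    have "augmentation m d (v 1) =
        (\<Sum>t\<in>Poly_Mapping.keys (v 1). smult (Poly_Mapping.lookup (v 1) t) (monom 1 s))"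
      unfolding augmentation_def by (intro sum.cong) (auto simp: deg smult_monom)
    also have "\<dots> \<in> pol.span B"
      using deg weighted_degree_in_semigroup[of m d]
      by (intro pol.span_sum pol.span_scale pol.span_base) (auto simp: B_def)
    finally show "augmentation m d (v 1) \<in> pol.span B" .
  qed
  have "B \<subseteq> ?V"
  proof (cases "s \<in> generated_semigroup d {1..m}")
    case True
    then obtain t where t: "Poly_Mapping.keys t \<subseteq> {1..m}" "weighted_degree m d t = s"
      using generated_semigroup_monomial by blast
    let ?v = "monomial_vector (1, t) :: nat \<Rightarrow> 'k mpoly"
    have "?v \<in> graded_piece m d 1 e s"
      using t assms by (auto simp: graded_piece_iff monomial_vector_def)
    moreover have "augmentation m d (?v 1) = monom 1 s"
      by (simp add: augmentation_def monomial_vector_def t)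
    ultimately show ?thesis using True unfolding B_def by (simp add: rev_image_eqI)
  qed (simp add: B_def)
  moreover have "pol.independent B"
    by (simp add: B_def pol.independent_empty)
  ultimately have "pol.dim ?V = card B"
    using pol.basis_card_eq_dim[OF _ sub] by simp
  thus ?thesis by (simp add: B_def)
qed

section \<open>The Hilbert series of the semigroup from a free resolution\<close>

text \<open>
  With \<open>e i\<close> the dimensions of the spaces in an exact complex and \<open>z i\<close> the dimensions of the
  kernels, rank and nullity give the two hypotheses, and \<open>h\<close> is the dimension of the
  cokernel of the complex.
\<close>

lemma alternating_sum_telescope:
  fixes e z :: "nat \<Rightarrow> int"
  assumes "e 0 = z 0 + h" "\<And>i. i \<in> {1..N} \<Longrightarrow> e i = z i + z (i - 1)"
  shows "(\<Sum>i\<le>N. (-1) ^ i * e i) = h + (-1) ^ N * z N"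
  using assms(2)
proof (induction N)
  case (Suc N)
  have "(\<Sum>i\<le>N. (-1) ^ i * e i) = h + (-1) ^ N * z N" using Suc by simp
  moreover have "e (Suc N) = z (Suc N) + z N" using Suc.prems[of "Suc N"] by simp
  ultimately show ?case by (simp add: algebra_simps)
qed (simp add: assms(1))

text \<open>
  The inner sum is the dimension of the degree \<open>s\<close> piece of \<open>F\<^sub>i\<close>. By exactness the
  kernels in the telescoping sum cancel, up to the last one, which is zero.
\<close>

lemma resolution_euler_characteristic:
  fixes A :: "nat \<Rightarrow> nat \<Rightarrow> nat \<Rightarrow> 'k::field mpoly"
  assumes m: "m \<ge> 2" and d: "\<forall>i\<in>{1..m}. 0 < d i"
    and res: "minimal_free_resolution m d b D A"
  shows "(\<Sum>i\<le>m-1. (-1) ^ i *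
      int (\<Sum>j=1..b i. if D j i \<le> s then card (monomials {1..m} d (s - D j i)) else 0)) =
    (if s \<in> generated_semigroup d {1..m} then 1 else 0)"
proof -
  let ?G = "\<lambda>i. graded_piece m d (b i) (\<lambda>j. D j i) s :: (nat \<Rightarrow> 'k mpoly) set"
  let ?f = "\<lambda>i. matrix_map (b i) (b (i-1)) (A i)"
  let ?aug = "\<lambda>v :: nat \<Rightarrow> 'k mpoly. augmentation m d (v 1)"
  \<comment> \<open>The map out of \<open>F\<^sub>0\<close> goes to the semigroup ring and is not given by a matrix; \<open>K\<close>
    treats its kernel uniformly with the others.\<close>
  define K where "K i v \<longleftrightarrow> (if i = 0 then ?aug v = 0 else ?f i v = 0)" for i v
  define Z where "Z i = {v \<in> ?G i. K i v}" for i
  have b0: "b 0 = 1" "D 1 0 = 0"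
    using res by (auto simp: minimal_free_resolution_def)
  have deg: "weighted_degree m d u + D r (i-1) = D j i"
    if "i \<in> {1..m-1}" "j \<in> {1..b i}" "r \<in> {1..b (i-1)}" "u \<in> Poly_Mapping.keys (A i j r)" for i j r u
  proof -
    have "\<forall>i\<in>{1..m-1}. \<forall>j\<in>{1..b i}. \<forall>r\<in>{1..b (i-1)}. \<forall>u\<in>Poly_Mapping.keys (A i j r).
        weighted_degree m d u + D r (i-1) = D j i"
      using res by (simp add: minimal_free_resolution_def)
    thus ?thesis using that by blast
  qed
  have span: "finite (monomial_vector ` homogeneous_indices m d (b i) (\<lambda>j. D j i) s)"
    "?G i \<subseteq> vec.span (monomial_vector ` homogeneous_indices m d (b i) (\<lambda>j. D j i) s)" for i
    by (rule finite_imageI[OF finite_homogeneous_indices[OF d]], rule graded_piece_span[OF d])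
  have img: "?f i ` ?G i = Z (i-1)" if i: "i \<in> {1..m-1}" for i
  proof -
    have "?f i ` free_module m (b i) = {v \<in> free_module m (b (i-1)). K (i-1) v}"
    proof (cases "i = 1")
      case True
      thus ?thesis
        using res unfolding minimal_free_resolution_def K_def by (elim conjE) simp
    next
      case False
      define i' where "i' = i - 1"
      have i': "i = i' + 1" "i' \<in> {1..<m-1}" using i False by (auto simp: i'_def)
      thus ?thesis
        using res by (simp add: minimal_free_resolution_def zero_fun_def K_def)
    qed
    thus ?thesis unfolding Z_def
      using deg[OF i] by (intro matrix_map_image_graded_piece) auto
  qed
  have rec: "vec.dim (?G i) = vec.dim (Z i) + vec.dim (Z (i-1))" if i: "i \<in> {1..m-1}" for i
    using vec_vec.rank_nullity_subspace[OF linear_matrix_map subspace_graded_piece span[of i],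
        of "b i" "b (i-1)" "A i"] i
    unfolding img[OF i] by (simp add: Z_def K_def)
  have aug: "vec.dim (?G 0) = vec.dim (Z 0) + (if s \<in> generated_semigroup d {1..m} then 1 else 0)"
    using vec_pol.rank_nullity_subspace[OF linear_augmentation[of m d]
        subspace_graded_piece span[of 0]]
      dim_augmentation_image[of "\<lambda>j. D j 0" m d s, where 'k = 'k] b0
    by (simp add: Z_def K_def)
  have "{v \<in> free_module m (b (m-1)). ?f (m-1) v = 0} = {0}"
    using res m by (auto simp: minimal_free_resolution_def zero_fun_def numeral_2_eq_2)
  hence "Z (m-1) \<subseteq> {0}" using m by (auto simp: Z_def K_def graded_piece_def)
  hence "vec.dim (Z (m-1)) = 0"
    using vec.dim_le_card[of "Z (m-1)" "{}"] by simp
  moreover have "(\<Sum>i\<le>m-1. (-1) ^ i * int (vec.dim (?G i))) =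
      (if s \<in> generated_semigroup d {1..m} then 1 else 0) + (-1) ^ (m-1) * int (vec.dim (Z (m-1)))"
    by (rule alternating_sum_telescope) (use rec aug in auto)
  ultimately show ?thesis by (simp add: dim_graded_piece[OF d])
qed

text \<open>
  The numerator \<open>Q\<close> of the Hilbert series before cancellation: the graded alternating sum of
  the ranks of the resolution.
\<close>

definition k_polynomial :: "nat \<Rightarrow> (nat \<Rightarrow> nat) \<Rightarrow> (nat \<Rightarrow> nat \<Rightarrow> nat) \<Rightarrow> complex poly" where
  "k_polynomial N b D = (\<Sum>i\<le>N. (-1) ^ i * (\<Sum>j=1..b i. monom 1 (D j i)))"

text \<open>
  Writing \<open>N\<close> for the generating function of the number of monomials, the coefficients of
  \<open>Q N\<close> are the Euler characteristics above, that is, the coefficients of the Hilbert series;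
  and \<open>N\<close> is the inverse of the product.
\<close>

lemma k_polynomial_hilbert_series:
  fixes A :: "nat \<Rightarrow> nat \<Rightarrow> nat \<Rightarrow> 'k::field mpoly"
  assumes m: "m \<ge> 2" and d: "\<forall>i\<in>{1..m}. 0 < d i"
    and res: "minimal_free_resolution m d b D A"
  shows "fps_of_poly (k_polynomial (m-1) b D) =
    hilbert_series (generated_semigroup d {1..m}) * (\<Prod>i\<in>{1..m}. 1 - fps_X ^ d i)"
proof -
  define N where "N = (Abs_fps (\<lambda>w. of_nat (card (monomials {1..m} d w))) :: complex fps)"
  let ?h = "\<lambda>i s. \<Sum>j=1..b i. if D j i \<le> s then card (monomials {1..m} d (s - D j i)) else 0"
  have Q: "fps_of_poly (k_polynomial (m-1) b D) =
      (\<Sum>i\<le>m-1. (-1) ^ i * (\<Sum>j=1..b i. fps_X ^ D j i))"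
    by (simp add: k_polynomial_def fps_of_poly_sum fps_of_poly_mult fps_of_poly_power
        fps_of_poly_uminus fps_of_poly_monom')
  have term_nth: "fps_nth ((-1) ^ i * (\<Sum>j=1..b i. fps_X ^ D j i) * N) s = (-1) ^ i * of_nat (?h i s)" for i s
  proof -
    have "fps_nth ((\<Sum>j=1..b i. fps_X ^ D j i) * N) s = of_nat (?h i s)"
      unfolding sum_distrib_right fps_sum_nth of_nat_sum
      by (intro sum.cong) (auto simp: fps_X_power_mult_nth N_def)
    thus ?thesis by (cases "even i") (simp_all add: mult.assoc)
  qed
  have eq: "fps_of_poly (k_polynomial (m-1) b D) * N = hilbert_series (generated_semigroup d {1..m})"
  proof (rule fps_ext)
    fix s
    have "fps_nth (fps_of_poly (k_polynomial (m-1) b D) * N) s =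
        of_int (\<Sum>i\<le>m-1. (-1) ^ i * int (?h i s))"
      unfolding Q sum_distrib_right fps_sum_nth term_nth by simp
    thus "fps_nth (fps_of_poly (k_polynomial (m-1) b D) * N) s =
        fps_nth (hilbert_series (generated_semigroup d {1..m})) s"
      unfolding resolution_euler_characteristic[OF m d res] by (simp add: hilbert_series_def)
  qed
  have "N * (\<Prod>i\<in>{1..m}. 1 - fps_X ^ d i) = 1"
    unfolding N_def by (rule monomials_generating_function) (use d in auto)
  hence "fps_of_poly (k_polynomial (m-1) b D) * 1 =
      fps_of_poly (k_polynomial (m-1) b D) * (N * (\<Prod>i\<in>{1..m}. 1 - fps_X ^ d i))"
    by (simp only:)
  also have "\<dots> = hilbert_series (generated_semigroup d {1..m}) * (\<Prod>i\<in>{1..m}. 1 - fps_X ^ d i)"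
    by (simp only: eq mult.assoc[symmetric])
  finally show ?thesis by (simp only: mult_1_right)
qed

text \<open>
  The degrees removed at odd and at even indices form the same multiset, and they enter with
  opposite signs.
\<close>

lemma cancelled_degrees_alternating_sum:
  fixes g :: "nat \<Rightarrow> 'a::comm_ring_1"
  assumes "cancelled_degrees m b D \<beta> C"
  shows "(\<Sum>l=1..m-1. (-1) ^ (l - 1) * (\<Sum>j=1..\<beta> l. g (C j l))) =
    (\<Sum>l=1..m-1. (-1) ^ (l - 1) * (\<Sum>j=1..b l. g (D j l)))"
proof -
  define E where "E l = degree_mset b D l - degree_mset \<beta> C l" for l
  define G where "G M = (\<Sum>x\<in>#M. g x)" for M
  have mset: "(\<Sum>j=1..c l. g (F j l)) = G (degree_mset c F l)" for c F l
    by (simp add: G_def degree_mset_def image_mset.compositionality comp_def sum_unfold_sum_mset)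
  have G_sum: "G (\<Sum>l\<in>L. E l) = (\<Sum>l\<in>L. G (E l))" for L
    by (induction L rule: infinite_finite_induct) (auto simp: G_def)
  have split: "G (degree_mset b D l) = G (degree_mset \<beta> C l) + G (E l)" if "l \<in> {1..m-1}" for l
  proof -
    have "degree_mset b D l = degree_mset \<beta> C l + E l"
      using assms that by (simp add: E_def cancelled_degrees_def)
    thus ?thesis by (simp add: G_def)
  qed
  have "(\<Sum>l=1..m-1. (-1) ^ (l - 1) * G (E l)) =
      (\<Sum>l=1..m-1. (if odd l then G (E l) else 0) - (if even l then G (E l) else 0))"
    by (intro sum.cong) auto
  also have "\<dots> = (\<Sum>l | l \<in> {1..m-1} \<and> odd l. G (E l)) - (\<Sum>l | l \<in> {1..m-1} \<and> even l. G (E l))"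
    unfolding sum_subtractf by (simp only: sum.inter_filter[symmetric] finite_atLeastAtMost)
  also have "\<dots> = 0"
    using assms unfolding G_sum[symmetric] by (simp add: cancelled_degrees_def E_def)
  finally have "(\<Sum>l=1..m-1. (-1) ^ (l - 1) * G (E l)) = 0" .
  moreover have "(\<Sum>l=1..m-1. (-1) ^ (l - 1) * G (degree_mset b D l)) =
      (\<Sum>l=1..m-1. (-1) ^ (l - 1) * G (degree_mset \<beta> C l)) + (\<Sum>l=1..m-1. (-1) ^ (l - 1) * G (E l))"
    unfolding sum.distrib[symmetric] by (intro sum.cong) (auto simp: split distrib_left)
  ultimately show ?thesis unfolding mset by simp
qed

theorem corollary1:
  fixes m :: nat and d :: "nat \<Rightarrow> nat"
    and b \<beta> :: "nat \<Rightarrow> nat" and D C :: "nat \<Rightarrow> nat \<Rightarrow> nat"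
    and A :: "nat \<Rightarrow> nat \<Rightarrow> nat \<Rightarrow> 'k::field mpoly"
    and k :: nat and n :: int
  assumes "m \<ge> 3"
    and "minimal_generators m d"
    and "minimal_free_resolution m d b D A"
    and "cancelled_degrees m b D \<beta> C"
    and "k \<in> {1..m}"
    and "gcd n (int (d k)) = 1" and "1 \<le> n" and "n < int (d k)"
  shows "(\<Sum>l=1..m-1. (-1) ^ (l - 1) *
           (\<Sum>j=1..\<beta> l. exp (\<i> * complex_of_real (2 * pi * of_int n / of_nat (d k)) * of_nat (C j l)))) = 1"
proof -
  define \<omega> where "\<omega> = exp (\<i> * complex_of_real (2 * pi * of_int n / of_nat (d k)))"
  have pow: "exp (\<i> * complex_of_real (2 * pi * of_int n / of_nat (d k)) * of_nat c) = \<omega> ^ c" for c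
    unfolding \<omega>_def by (rule exp_of_nat2_mult)
  have m: "m \<ge> 2" using assms(1) by simp
  have d: "\<forall>i\<in>{1..m}. 0 < d i" and Gcd: "Gcd (d ` {1..m}) = 1"
    using assms(2) by (auto simp: minimal_generators_def)
  \<comment> \<open>Rules out \<open>\<omega> = 1\<close>, where every generator would satisfy \<open>\<omega> ^ d l = 1\<close>.\<close>
  have "1 < d k" using assms(7,8) by linarith
  from root_of_unity_generator[OF Gcd assms(5,6) this]
  obtain l where "\<omega> ^ d k = 1" "l \<in> {1..m}" "\<omega> ^ d l \<noteq> 1" unfolding \<omega>_def by blast
  hence "poly (k_polynomial (m-1) b D) \<omega> = 0"
    using hilbert_numerator_root[OF _ d k_polynomial_hilbert_series[OF m d assms(3)] assms(5)]
    by simp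
  hence "0 = (\<Sum>i\<le>m-1. (-1) ^ i * (\<Sum>j=1..b i. \<omega> ^ D j i))"
    by (simp add: k_polynomial_def poly_sum poly_monom)
  also have "\<dots> = (\<Sum>j=1..b 0. \<omega> ^ D j 0) + (\<Sum>i=1..m-1. (-1) ^ i * (\<Sum>j=1..b i. \<omega> ^ D j i))"
    by (simp add: atMost_atLeast0 sum.atLeast_Suc_atMost)
  also have "(\<Sum>j=1..b 0. \<omega> ^ D j 0) = 1"
    using assms(3) by (simp add: minimal_free_resolution_def)
  also have "(\<Sum>i=1..m-1. (-1) ^ i * (\<Sum>j=1..b i. \<omega> ^ D j i)) =
      - (\<Sum>l=1..m-1. (-1) ^ (l - 1) * (\<Sum>j=1..b l. \<omega> ^ D j l))"
    unfolding sum_negf[symmetric] by (intro sum.cong) (auto simp: power_eq_if)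
  finally have "(\<Sum>l=1..m-1. (-1) ^ (l - 1) * (\<Sum>j=1..b l. \<omega> ^ D j l)) = 1" by simp
  thus ?thesis
    unfolding pow using cancelled_degrees_alternating_sum[OF assms(4), of "\<lambda>c. \<omega> ^ c"] by simp
qed

end
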